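(* Let $G$ and $H$ be finite simple undirected graphs. The ideal of weak graph homomorphisms $I_{G\to H}$ is unmixed if and only if $G$ is totally disconnected or $H$ is a disjoint union of complete graphs.
   Context: All graphs are finite, simple, undirected, with nonempty vertex sets. Let $V(G)=[n]=\{1,\dots,n\}$ and $V(H)=[m]$. A weak homomorphism from $G$ to $H$ is a map $\phi:V(G)\to V(H)$ such that for every $\{x,y\}\in E(G)$ either $\phi(x)=\phi(y)$ or $\{\phi(x),\phi(y)\}\in E(H)$; the set of these is $\mathrm{WHom}(G,H)$. Let $K$ be a field and $S=K[x_{ij}: i\in[n], j\in[m]]$. For $\phi\in\mathrm{WHom}(G,H)$ put $u_\phi=\prod_{i=1}^n x_{i\phi(i)}$, and $I_{G\to H}=(u_\phi:\phi\in\mathrm{WHom}(G,H))\subseteq S$. $G$ is totally disconnected if $E(G)=\emptyset$. A monomial ideal is unmixed if all its associated primes have the same height. Disjoint unions may have one component, and a single vertex is a complete graph. *)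

theory Defs
  imports
    "HOL-Library.Poly_Mapping"
    "HOL-Library.Extended_Nat"
    "HOL-Library.Disjoint_Sets"
    "HOL-Algebra.Algebraic_Closure_Type"
begin

section \<open>Graphs\<close>

text \<open>
  A graph is given by its edge set; its vertex set is the whole vertex type, which the theorem
  takes to be of class finite (hence finite and nonempty).
\<close>

definition simple_graph :: "'a set set \<Rightarrow> bool" where
  "simple_graph G \<longleftrightarrow> (\<forall>e\<in>G. card e = 2)"

definition totally_disconnected :: "'a set set \<Rightarrow> bool" where
  "totally_disconnected G \<longleftrightarrow> G = {}"

definition disjoint_union_of_complete_graphs :: "'b set set \<Rightarrow> bool" where
  "disjoint_union_of_complete_graphs H \<longleftrightarrow>
     (\<exists>P. partition_on UNIV P \<and> H = {{x, y} |x y. x \<noteq> y \<and> (\<exists>C\<in>P. x \<in> C \<and> y \<in> C)})"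

definition WHom :: "'a set set \<Rightarrow> 'b set set \<Rightarrow> ('a \<Rightarrow> 'b) set" where
  "WHom G H = {\<phi>. \<forall>x y. {x, y} \<in> G \<longrightarrow> \<phi> x = \<phi> y \<or> {\<phi> x, \<phi> y} \<in> H}"

section \<open>Associated primes, height and unmixedness\<close>

text \<open>
  The associated primes of \<open>I\<close> are those of the module \<open>R/I\<close>: the prime ideals of the form
  \<open>ann(f + I) = (I : f)\<close>. Primality forces \<open>f \<notin> I\<close>.
\<close>

definition associated_primes :: "('r, 'm) ring_scheme \<Rightarrow> 'r set \<Rightarrow> 'r set set" where
  "associated_primes R I =
     {P. primeideal P R \<and> (\<exists>f\<in>carrier R. P = {r \<in> carrier R. r \<otimes>\<^bsub>R\<^esub> f \<in> I})}"

definition prime_height :: "('r, 'm) ring_scheme \<Rightarrow> 'r set \<Rightarrow> enat" where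
  "prime_height R P =
     Sup {enat k |k. \<exists>Q :: nat \<Rightarrow> 'r set.
       (\<forall>i\<le>k. primeideal (Q i) R) \<and> (\<forall>i<k. Q i \<subset> Q (Suc i)) \<and> Q k = P}"

definition unmixed :: "('r, 'm) ring_scheme \<Rightarrow> 'r set \<Rightarrow> bool" where
  "unmixed R I \<longleftrightarrow>
     (\<forall>P\<in>associated_primes R I. \<forall>Q\<in>associated_primes R I. prime_height R P = prime_height R Q)"

section \<open>The ideal of weak graph homomorphisms\<close>

text \<open>
  The polynomial ring \<open>K[x\<^sub>i\<^sub>j]\<close>: a monomial is an exponent vector
  \<^typ>\<open>('a \<times> 'b) \<Rightarrow>\<^sub>0 nat\<close>, a polynomial a finitely supported map from monomials
  to coefficients, and multiplication is convolution.
\<close>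

type_synonym ('a, 'b, 'k) xpoly = "(('a \<times> 'b) \<Rightarrow>\<^sub>0 nat) \<Rightarrow>\<^sub>0 'k"

abbreviation xpoly_ring :: "('a, 'b, 'k::field) xpoly ring" where
  "xpoly_ring \<equiv> ring_of_type_algebra"

definition xvar :: "'a \<Rightarrow> 'b \<Rightarrow> ('a, 'b, 'k::field) xpoly" where
  "xvar i j = Poly_Mapping.single (Poly_Mapping.single (i, j) 1) 1"

definition whom_monomial :: "('a::finite \<Rightarrow> 'b) \<Rightarrow> ('a, 'b, 'k::field) xpoly" where
  "whom_monomial \<phi> = (\<Prod>i\<in>UNIV. xvar i (\<phi> i))"

definition whom_ideal :: "'a::finite set set \<Rightarrow> 'b set set \<Rightarrow> ('a, 'b, 'k::field) xpoly set" where
  "whom_ideal G H = Idl\<^bsub>xpoly_ring\<^esub> (whom_monomial ` WHom G H)"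

end

theory Submission
  imports Defs
begin

text \<open>
  The generators of the ideal are the squarefree monomials supported on the graphs of weak
  homomorphisms, so its associated primes are the ideals generated by the variables of a minimal
  transversal \<open>C\<close> of these graphs, and such a prime has height \<open>|C|\<close>. The upper bound on the
  height needs only that a chain of primes in a polynomial ring in \<open>N\<close> variables has length at
  most \<open>N\<close>: a chain of length \<open>k\<close> yields \<open>k\<close> algebraically independent polynomials, and
  counting monomials of bounded exponents gives \<open>k \<le> N\<close>.

  It remains to see when all minimal transversals have the same size. The rows \<open>{i} \<times> V(H)\<close>
  are minimal transversals. If \<open>G\<close> has an edge and \<open>H\<close> an induced path on three vertices, some
  minimal transversal meets every column, because constant maps are weak homomorphisms, and meets
  one column twice.
\<close>

section \<open>Ideals of a type-based ring\<close>

text \<open>Negatives come from multiplying by \<open>- 1\<close>, so the subgroup condition reduces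
  to zero and sums. Later arguments can then use type-class arithmetic throughout.\<close>

lemma ideal_type_algebra_iff:
  fixes I :: "'r::comm_ring_1 set"
  shows "ideal I ring_of_type_algebra \<longleftrightarrow>
    0 \<in> I \<and> (\<forall>a\<in>I. \<forall>b\<in>I. a + b \<in> I) \<and> (\<forall>r. \<forall>a\<in>I. r * a \<in> I)" (is "?L \<longleftrightarrow> ?R")
proof
  assume ?L
  then interpret ideal I "ring_of_type_algebra :: 'r ring" .
  show ?R
    using additive_subgroup.zero_closed[OF additive_subgroup_axioms]
      additive_subgroup.a_closed[OF additive_subgroup_axioms] I_l_closed
    by (auto simp: ring_of_type_algebra_def)
next
  assume R: ?R
  interpret cring "ring_of_type_algebra :: 'r ring" by (rule cring_from_type_algebra)
  have minus: "\<ominus>\<^bsub>ring_of_type_algebra\<^esub> a = - a" for a :: 'r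
    using minus_equality[of "- a" a] by (auto simp: ring_of_type_algebra_def)
  have "- a \<in> I" if "a \<in> I" for a
    using R that by (metis mult_minus1)
  then have "subgroup I (add_monoid (ring_of_type_algebra :: 'r ring))"
    using R minus by (intro add.subgroupI) (auto simp: ring_of_type_algebra_def)
  moreover have "r * a \<in> I" "a * r \<in> I" if "a \<in> I" for a r
    using R that by (simp_all add: mult.commute[of a])
  ultimately show ?L
    by (intro idealI ring_axioms) (auto simp: ring_of_type_algebra_def)
qed

lemma primeideal_type_algebra_iff:
  fixes P :: "'r::comm_ring_1 set"
  shows "primeideal P ring_of_type_algebra \<longleftrightarrow>
    ideal P ring_of_type_algebra \<and> 1 \<notin> P \<and> (\<forall>a b. a * b \<in> P \<longrightarrow> a \<in> P \<or> b \<in> P)" (is "?L \<longleftrightarrow> ?R")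
proof
  assume ?L
  then interpret primeideal P "ring_of_type_algebra :: 'r ring" .
  have "1 \<notin> P"
    using one_imp_carrier I_notcarr by (auto simp: ring_of_type_algebra_def)
  moreover have "\<forall>a b. a * b \<in> P \<longrightarrow> a \<in> P \<or> b \<in> P"
    using I_prime by (simp add: ring_of_type_algebra_def)
  ultimately show ?R
    using is_ideal by blast
next
  assume ?R
  then show ?L
    by (intro primeidealI cring_from_type_algebra) (auto simp: ring_of_type_algebra_def)
qed

lemma ideal_sum_closed:
  fixes I :: "'r::comm_ring_1 set"
  assumes "ideal I ring_of_type_algebra" and "\<And>x. x \<in> A \<Longrightarrow> f x \<in> I"
  shows "sum f A \<in> I"
  using assms by (induction A rule: infinite_finite_induct) (auto simp: ideal_type_algebra_iff)

lemma primeideal_prod_memD: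
  fixes P :: "'r::comm_ring_1 set"
  assumes "primeideal P ring_of_type_algebra" and "finite A" and "prod f A \<in> P"
  shows "\<exists>x\<in>A. f x \<in> P"
proof -
  have "1 \<notin> P" and prime: "\<And>a b. a * b \<in> P \<Longrightarrow> a \<in> P \<or> b \<in> P"
    using assms(1) unfolding primeideal_type_algebra_iff by blast+
  with assms(2,3) show ?thesis
    by (induction A rule: finite_induct) auto
qed

text \<open>If every \<open>J x\<close> had an element outside \<open>P\<close>, the product of
  these elements would lie in all the \<open>J x\<close>, hence in \<open>P\<close>, against
  primality. For empty \<open>A\<close> this product is 1.\<close>

lemma primeideal_INT_subset:
  fixes P :: "'r::comm_ring_1 set"
  assumes P: "primeideal P ring_of_type_algebra" and fin: "finite A"
    and J: "\<And>x. x \<in> A \<Longrightarrow> ideal (J x) ring_of_type_algebra"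
    and sub: "(\<Inter>x\<in>A. J x) \<subseteq> P"
  shows "\<exists>x\<in>A. J x \<subseteq> P"
proof (rule ccontr)
  assume "\<not> ?thesis"
  then obtain g where g: "\<And>x. x \<in> A \<Longrightarrow> g x \<in> J x \<and> g x \<notin> P"
    unfolding subset_iff by metis
  have "prod g A \<in> J x" if "x \<in> A" for x
  proof -
    have "prod g A = prod g (A - {x}) * g x"
      using fin that by (simp add: prod.remove mult.commute)
    then show ?thesis
      using g[OF that] J[OF that] by (auto simp: ideal_type_algebra_iff)
  qed
  then have "prod g A \<in> P"
    using sub by blast
  then show False
    using primeideal_prod_memD[OF P fin] g by blast
qed

section \<open>Polynomials\<close>

type_synonym ('v, 'k) mpolynomial = "('v \<Rightarrow>\<^sub>0 nat) \<Rightarrow>\<^sub>0 'k"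

lemma polynomial_eq_sum_terms:
  fixes p :: "'m \<Rightarrow>\<^sub>0 'k::comm_monoid_add"
  shows "p = (\<Sum>m\<in>Poly_Mapping.keys p. Poly_Mapping.single m (Poly_Mapping.lookup p m))"
  by (rule poly_mapping_eqI) (auto simp: lookup_sum lookup_single when_def in_keys_iff)

lemma keys_add_eq_Un:
  fixes a b :: "'v \<Rightarrow>\<^sub>0 nat"
  shows "Poly_Mapping.keys (a + b) = Poly_Mapping.keys a \<union> Poly_Mapping.keys b"
  by (auto simp: in_keys_iff lookup_add)

text \<open>Two finite sets of exponent vectors have a sum that is attained only once: compare
  the vectors lexicographically.\<close>

lemma unique_sum_exponents:
  fixes A B :: "('v \<Rightarrow>\<^sub>0 nat) set"
  assumes "finite W" and "finite A" "A \<noteq> {}" and "finite B" "B \<noteq> {}"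
    and "\<And>a a' v. a \<in> A \<Longrightarrow> a' \<in> A \<Longrightarrow> v \<notin> W \<Longrightarrow> Poly_Mapping.lookup a v = Poly_Mapping.lookup a' v"
    and "\<And>b b' v. b \<in> B \<Longrightarrow> b' \<in> B \<Longrightarrow> v \<notin> W \<Longrightarrow> Poly_Mapping.lookup b v = Poly_Mapping.lookup b' v"
  shows "\<exists>a\<in>A. \<exists>b\<in>B. \<forall>a'\<in>A. \<forall>b'\<in>B. a' + b' = a + b \<longrightarrow> a' = a \<and> b' = b"
  using assms
proof (induction W arbitrary: A B rule: finite_induct)
  case empty
  have "a' = a" if "a \<in> A" "a' \<in> A" for a a'
    using empty(5)[OF that(2,1)] by (simp add: poly_mapping_eqI)
  moreover have "b' = b" if "b \<in> B" "b' \<in> B" for b b'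
    using empty(6)[OF that(2,1)] by (simp add: poly_mapping_eqI)
  moreover obtain a b where "a \<in> A" "b \<in> B"
    using empty by blast
  ultimately show ?case
    by meson
next
  case (insert w W)
  have top: "\<exists>n. {a \<in> S. Poly_Mapping.lookup a w = n} \<noteq> {} \<and> (\<forall>a\<in>S. Poly_Mapping.lookup a w \<le> n)"
    if "finite S" "S \<noteq> {}" for S :: "('v \<Rightarrow>\<^sub>0 nat) set"
  proof -
    let ?n = "Max ((\<lambda>a. Poly_Mapping.lookup a w) ` S)"
    have "?n \<in> (\<lambda>a. Poly_Mapping.lookup a w) ` S"
      using that by (intro Max_in) auto
    then obtain a where "a \<in> S" "Poly_Mapping.lookup a w = ?n"
      by auto
    moreover have "\<forall>a\<in>S. Poly_Mapping.lookup a w \<le> ?n"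
      using that by auto
    ultimately show ?thesis
      by (intro exI[of _ ?n]) blast
  qed
  obtain m where m: "{a \<in> A. Poly_Mapping.lookup a w = m} \<noteq> {}" "\<forall>a\<in>A. Poly_Mapping.lookup a w \<le> m"
    using top[OF insert.prems(1,2)] by blast
  obtain n where n: "{b \<in> B. Poly_Mapping.lookup b w = n} \<noteq> {}" "\<forall>b\<in>B. Poly_Mapping.lookup b w \<le> n"
    using top[OF insert.prems(3,4)] by blast
  \<comment> \<open>Vectors with the largest exponent at \<open>w\<close> agree there, so the
    induction hypothesis applies to them. A sum with exponent \<open>m + n\<close> at
    \<open>w\<close> can only come from such vectors.\<close>
  define A' where "A' = {a \<in> A. Poly_Mapping.lookup a w = m}"
  define B' where "B' = {b \<in> B. Poly_Mapping.lookup b w = n}"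
  have A': "\<And>a. a \<in> A' \<longleftrightarrow> a \<in> A \<and> Poly_Mapping.lookup a w = m"
    and B': "\<And>b. b \<in> B' \<longleftrightarrow> b \<in> B \<and> Poly_Mapping.lookup b w = n"
    and ne: "A' \<noteq> {}" "B' \<noteq> {}" and fin: "finite A'" "finite B'"
    using m(1) n(1) insert.prems(1,3) by (simp_all add: A'_def B'_def)
  have agree: "Poly_Mapping.lookup a v = Poly_Mapping.lookup a' v"
    if "a \<in> A'" "a' \<in> A'" "v \<notin> W" for a a' v
    using that A' insert.prems(5)[of a a' v] by (cases "v = w") auto
  have agree': "Poly_Mapping.lookup b v = Poly_Mapping.lookup b' v"
    if "b \<in> B'" "b' \<in> B'" "v \<notin> W" for b b' v
    using that B' insert.prems(6)[of b b' v] by (cases "v = w") auto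
  obtain a b where ab: "a \<in> A'" "b \<in> B'"
    and uniq: "\<And>a' b'. a' \<in> A' \<Longrightarrow> b' \<in> B' \<Longrightarrow> a' + b' = a + b \<Longrightarrow> a' = a \<and> b' = b"
    using insert.IH[OF fin(1) ne(1) fin(2) ne(2) agree agree'] by blast
  have "a' = a \<and> b' = b" if "a' \<in> A" "b' \<in> B" and eq: "a' + b' = a + b" for a' b'
  proof -
    have "Poly_Mapping.lookup a' w + Poly_Mapping.lookup b' w = m + n"
      using arg_cong[OF eq, of "\<lambda>x. Poly_Mapping.lookup x w"] ab by (simp add: lookup_add A' B')
    moreover have "Poly_Mapping.lookup a' w \<le> m" "Poly_Mapping.lookup b' w \<le> n"
      using that m(2) n(2) by auto
    ultimately have "a' \<in> A'" "b' \<in> B'"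
      using that by (auto simp: A' B')
    then show ?thesis
      using uniq eq by blast
  qed
  moreover have "a \<in> A" "b \<in> B"
    using ab by (simp_all add: A' B')
  ultimately show ?case
    by blast
qed

section \<open>Ideals described by supports of monomials\<close>

text \<open>This is the ideal generated by the variables in \<open>C\<close>, encoded by membership
  so that inclusions and intersections become statements about supports.\<close>

definition var_prime :: "'v set \<Rightarrow> ('v, 'k::field) mpolynomial set" where
  "var_prime C = {p. \<forall>m\<in>Poly_Mapping.keys p. Poly_Mapping.keys m \<inter> C \<noteq> {}}"

text \<open>For finite edges this is the squarefree monomial ideal generated by the products of the
  variables of each edge.\<close>

definition edge_ideal :: "'v set set \<Rightarrow> ('v, 'k::field) mpolynomial set" where
  "edge_ideal E = {p. \<forall>m\<in>Poly_Mapping.keys p. \<exists>e\<in>E. e \<subseteq> Poly_Mapping.keys m}"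

text \<open>Multiplication only enlarges the supports of monomials. This handles
  \<open>var_prime\<close> and \<open>edge_ideal\<close> at once.\<close>

lemma ideal_of_upward_closed:
  fixes Q :: "'v set \<Rightarrow> bool"
  assumes "\<And>A B. Q A \<Longrightarrow> A \<subseteq> B \<Longrightarrow> Q B"
  shows "ideal {p :: ('v, 'k::field) mpolynomial. \<forall>m\<in>Poly_Mapping.keys p. Q (Poly_Mapping.keys m)}
    ring_of_type_algebra"
  unfolding ideal_type_algebra_iff
proof (intro conjI ballI allI)
  show "0 \<in> {p :: ('v, 'k) mpolynomial. \<forall>m\<in>Poly_Mapping.keys p. Q (Poly_Mapping.keys m)}"
    by simp
next
  fix p q :: "('v, 'k) mpolynomial"
  assume "p \<in> {p. \<forall>m\<in>Poly_Mapping.keys p. Q (Poly_Mapping.keys m)}"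
    "q \<in> {p. \<forall>m\<in>Poly_Mapping.keys p. Q (Poly_Mapping.keys m)}"
  then show "p + q \<in> {p. \<forall>m\<in>Poly_Mapping.keys p. Q (Poly_Mapping.keys m)}"
    using Poly_Mapping.keys_add[of p q] by blast
next
  fix r p :: "('v, 'k) mpolynomial"
  assume "p \<in> {p. \<forall>m\<in>Poly_Mapping.keys p. Q (Poly_Mapping.keys m)}"
  then have "Q (Poly_Mapping.keys (a + b))" if "b \<in> Poly_Mapping.keys p" for a b
    using that assms[of "Poly_Mapping.keys b" "Poly_Mapping.keys (a + b)"]
    by (auto simp: keys_add_eq_Un)
  then show "r * p \<in> {p. \<forall>m\<in>Poly_Mapping.keys p. Q (Poly_Mapping.keys m)}"
    using keys_mult[of r p] by blast
qed

lemma ideal_var_prime: "ideal (var_prime C :: ('v, 'k::field) mpolynomial set) ring_of_type_algebra"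
  unfolding var_prime_def by (rule ideal_of_upward_closed) auto

lemma ideal_edge_ideal: "ideal (edge_ideal E :: ('v, 'k::field) mpolynomial set) ring_of_type_algebra"
  unfolding edge_ideal_def by (rule ideal_of_upward_closed) blast

lemma lookup_mult_eq_single_product:
  fixes p q :: "('v, 'k::field) mpolynomial"
  assumes "a \<in> Poly_Mapping.keys p" "b \<in> Poly_Mapping.keys q"
    and uniq: "\<And>a' b'. a' \<in> Poly_Mapping.keys p \<Longrightarrow> b' \<in> Poly_Mapping.keys q \<Longrightarrow> a' + b' = a + b
      \<Longrightarrow> a' = a \<and> b' = b"
  shows "Poly_Mapping.lookup (p * q) (a + b) = Poly_Mapping.lookup p a * Poly_Mapping.lookup q b"
proof -
  let ?t = "\<lambda>a' b'. Poly_Mapping.single (a' + b') (Poly_Mapping.lookup p a' * Poly_Mapping.lookup q b')"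
  have "p * q = (\<Sum>a'\<in>Poly_Mapping.keys p. Poly_Mapping.single a' (Poly_Mapping.lookup p a')) *
      (\<Sum>b'\<in>Poly_Mapping.keys q. Poly_Mapping.single b' (Poly_Mapping.lookup q b'))"
    using polynomial_eq_sum_terms[of p] polynomial_eq_sum_terms[of q] by metis
  also have "\<dots> = (\<Sum>a'\<in>Poly_Mapping.keys p. \<Sum>b'\<in>Poly_Mapping.keys q. ?t a' b')"
    by (simp add: sum_product mult_single)
  finally have "Poly_Mapping.lookup (p * q) (a + b) =
      (\<Sum>a'\<in>Poly_Mapping.keys p. \<Sum>b'\<in>Poly_Mapping.keys q. Poly_Mapping.lookup (?t a' b') (a + b))"
    by (simp add: lookup_sum)
  also have "\<dots> = (\<Sum>a'\<in>Poly_Mapping.keys p. \<Sum>b'\<in>Poly_Mapping.keys q.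
      if a' = a then if b' = b then Poly_Mapping.lookup p a * Poly_Mapping.lookup q b else 0 else 0)"
    using uniq by (intro sum.cong refl) (auto simp: lookup_single when_def)
  also have "\<dots> = Poly_Mapping.lookup p a * Poly_Mapping.lookup q b"
  proof -
    have "(\<Sum>b'\<in>Poly_Mapping.keys q. if a' = a then if b' = b then c else 0 else 0) =
        (if a' = a then c else 0)" for a' and c :: 'k
      using assms(2) by (cases "a' = a") simp_all
    then show ?thesis
      using assms(1) by simp
  qed
  finally show ?thesis .
qed

text \<open>If neither factor lies in the ideal, both have terms free of the variables in
  \<open>C\<close>. Among these terms some exponent sum is attained only once, so it survives in the
  product.\<close>

lemma primeideal_var_prime:
  fixes C :: "'v::finite set"
  shows "primeideal (var_prime C :: ('v, 'k::field) mpolynomial set) ring_of_type_algebra"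
  unfolding primeideal_type_algebra_iff
proof (intro conjI allI impI)
  show "ideal (var_prime C :: ('v, 'k) mpolynomial set) ring_of_type_algebra"
    by (rule ideal_var_prime)
  show "(1 :: ('v, 'k) mpolynomial) \<notin> var_prime C"
    by (simp add: var_prime_def)
  fix p q :: "('v, 'k) mpolynomial"
  assume pq: "p * q \<in> var_prime C"
  let ?R = "\<lambda>p :: ('v, 'k) mpolynomial. {m \<in> Poly_Mapping.keys p. Poly_Mapping.keys m \<inter> C = {}}"
  show "p \<in> var_prime C \<or> q \<in> var_prime C"
  proof (rule ccontr)
    assume "\<not> ?thesis"
    then have "?R p \<noteq> {}" "?R q \<noteq> {}"
      by (auto simp: var_prime_def)
    then obtain a b where ab: "a \<in> ?R p" "b \<in> ?R q"
      "\<forall>a'\<in>?R p. \<forall>b'\<in>?R q. a' + b' = a + b \<longrightarrow> a' = a \<and> b' = b"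
      using unique_sum_exponents[of UNIV "?R p" "?R q"] by auto
    have "Poly_Mapping.lookup (p * q) (a + b) = Poly_Mapping.lookup p a * Poly_Mapping.lookup q b"
    proof (rule lookup_mult_eq_single_product)
      fix a' b'
      assume *: "a' \<in> Poly_Mapping.keys p" "b' \<in> Poly_Mapping.keys q" "a' + b' = a + b"
      \<comment> \<open>A sum whose support misses \<open>C\<close> has summands whose supports miss
        \<open>C\<close>, so the remaining terms of \<open>p\<close> and \<open>q\<close> cannot
        interfere.\<close>
      have "Poly_Mapping.keys a' \<union> Poly_Mapping.keys b' = Poly_Mapping.keys a \<union> Poly_Mapping.keys b"
        using *(3) by (metis keys_add_eq_Un)
      then have "a' \<in> ?R p" "b' \<in> ?R q"
        using * ab(1,2) by blast+
      then show "a' = a \<and> b' = b"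
        using ab *(3) by blast
    qed (use ab in auto)
    then have "a + b \<in> Poly_Mapping.keys (p * q)"
      using ab by (auto simp: in_keys_iff)
    moreover have "Poly_Mapping.keys (a + b) \<inter> C = {}"
      using ab by (auto simp: keys_add_eq_Un)
    ultimately show False
      using pq by (auto simp: var_prime_def)
  qed
qed

section \<open>Heights of the primes generated by variables\<close>

text \<open>The monomials in \<open>M\<close> span a space containing all \<open>F i\<close>.
  Independence is stated for the indexed family, so a repeated member would give a relation with
  coefficients 1 and -1.\<close>

lemma card_le_of_independent_family:
  fixes F :: "nat \<Rightarrow> ('m::comm_monoid_add \<Rightarrow>\<^sub>0 'k::field)"
  assumes fin: "finite M" and keys: "\<And>i. i < n \<Longrightarrow> Poly_Mapping.keys (F i) \<subseteq> M"
    and indep: "\<And>c i. (\<Sum>j<n. Poly_Mapping.single 0 (c j) * F j) = 0 \<Longrightarrow> i < n \<Longrightarrow> c i = 0"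
  shows "n \<le> card M"
proof -
  interpret vector_space "\<lambda>(c::'k) (p :: 'm \<Rightarrow>\<^sub>0 'k). Poly_Mapping.single 0 c * p"
    by unfold_locales (simp_all add: algebra_simps single_add mult_single flip: mult.assoc)
  have inj: "inj_on F {..<n}"
  proof (rule inj_onI, rule ccontr)
    fix i j assume ij: "i \<in> {..<n}" "j \<in> {..<n}" "F i = F j" "i \<noteq> j"
    define c :: "nat \<Rightarrow> 'k" where "c l = (if l = i then 1 else if l = j then -1 else 0)" for l
    have "(\<Sum>l<n. Poly_Mapping.single 0 (c l) * F l) = (\<Sum>l\<in>{i, j}. Poly_Mapping.single 0 (c l) * F l)"
      using ij by (intro sum.mono_neutral_right) (auto simp: c_def)
    also have "\<dots> = 0"
      using ij by (simp add: c_def flip: distrib_right single_add)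
    finally have "c i = 0"
      using indep ij by blast
    then show False
      by (simp add: c_def)
  qed
  have "independent (F ` {..<n})"
  proof (rule independent_if_scalars_zero)
    fix f p
    assume 0: "(\<Sum>x\<in>F ` {..<n}. Poly_Mapping.single 0 (f x) * x) = 0" and "p \<in> F ` {..<n}"
    then obtain i where "i < n" "p = F i"
      by auto
    then show "f p = 0"
      using 0 indep[of "f \<circ> F" i] by (simp add: sum.reindex[OF inj])
  qed simp
  moreover have "F ` {..<n} \<subseteq> span ((\<lambda>m. Poly_Mapping.single m 1) ` M)"
  proof
    fix p assume "p \<in> F ` {..<n}"
    then have "Poly_Mapping.keys p \<subseteq> M"
      using keys by auto
    then have "(\<Sum>m\<in>Poly_Mapping.keys p. Poly_Mapping.single 0 (Poly_Mapping.lookup p m) * Poly_Mapping.single m 1)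
        \<in> span ((\<lambda>m. Poly_Mapping.single m 1) ` M)"
      by (intro span_sum span_scale span_base) auto
    then show "p \<in> span ((\<lambda>m. Poly_Mapping.single m 1) ` M)"
      using polynomial_eq_sum_terms[of p] by (simp add: mult_single)
  qed
  ultimately have "card (F ` {..<n}) \<le> card ((\<lambda>m. Poly_Mapping.single m (1::'k)) ` M)"
    using independent_span_bound fin by blast
  also have "\<dots> \<le> card M"
    using fin by (rule card_image_le)
  finally show ?thesis
    by (simp add: card_image inj)
qed

text \<open>Exponents range over the digits of \<open>n\<close> in base \<open>D\<close>.\<close>

primrec digit_product :: "nat \<Rightarrow> (nat \<Rightarrow> 'r::comm_monoid_mult) \<Rightarrow> nat \<Rightarrow> nat \<Rightarrow> 'r" where
  "digit_product D g 0 n = 1"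
| "digit_product D g (Suc k) n = g k ^ (n div D ^ k) * digit_product D g k (n mod D ^ k)"

text \<open>Modulo \<open>R\<close> only \<open>h 0\<close> remains, so it vanishes. The rest is
  \<open>g\<close> times a shorter combination, and the prime \<open>R'\<close>, which omits
  \<open>g\<close>, contains that combination.\<close>

lemma poly_combination_eq_zero:
  fixes R R' :: "'r::comm_ring_1 set"
  assumes R': "primeideal R' ring_of_type_algebra" and R: "ideal R ring_of_type_algebra"
    and "R' \<subseteq> R" and g: "g \<in> R" "g \<notin> R'"
    and "\<And>t. t < D \<Longrightarrow> h t \<in> R \<Longrightarrow> h t = 0"
    and "(\<Sum>t<D. g ^ t * h t) \<in> R'"
    and "t < D"
  shows "h t = 0"
  using assms(6-8)
proof (induction D arbitrary: h t)
  case (Suc D)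
  have split: "(\<Sum>t<Suc D. g ^ t * h t) = h 0 + g * (\<Sum>t<D. g ^ t * h (Suc t))"
    by (simp only: sum.lessThan_Suc_shift) (simp add: sum_distrib_left mult.assoc)
  have "h 0 + g * (\<Sum>t<D. g ^ t * h (Suc t)) \<in> R"
    using Suc.prems(2) \<open>R' \<subseteq> R\<close> unfolding split by blast
  moreover have "- (\<Sum>t<D. g ^ t * h (Suc t)) * g \<in> R"
    using R g(1) unfolding ideal_type_algebra_iff by blast
  ultimately have "(h 0 + g * (\<Sum>t<D. g ^ t * h (Suc t))) + - (\<Sum>t<D. g ^ t * h (Suc t)) * g \<in> R"
    using R unfolding ideal_type_algebra_iff by blast
  then have "h 0 \<in> R"
    by (simp add: mult.commute)
  then have h0: "h 0 = 0"
    using Suc.prems(1) by blast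
  then have "g * (\<Sum>t<D. g ^ t * h (Suc t)) \<in> R'"
    using Suc.prems(2) unfolding split by simp
  then have "(\<Sum>t<D. g ^ t * h (Suc t)) \<in> R'"
    using R' g(2) unfolding primeideal_type_algebra_iff by blast
  then have "h (Suc s) = 0" if "s < D" for s
    using Suc.IH[of "\<lambda>t. h (Suc t)" s] Suc.prems(1) that by simp
  then show ?case
    using h0 Suc.prems(3) by (cases t) auto
qed simp

text \<open>Picking one element from each step of a descending chain of primes gives algebraically
  independent elements: strip the powers of the element of the lowest step first.\<close>

lemma digit_products_independent:
  fixes R :: "nat \<Rightarrow> ('m::comm_monoid_add \<Rightarrow>\<^sub>0 'k::field) set"
  assumes "\<And>i. i \<le> k \<Longrightarrow> primeideal (R i) ring_of_type_algebra"
    and "\<And>i. i < k \<Longrightarrow> R (Suc i) \<subseteq> R i \<and> g i \<in> R i \<and> g i \<notin> R (Suc i)"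
    and "(\<Sum>n<D ^ k. Poly_Mapping.single 0 (c n) * digit_product D g k n) \<in> R k"
    and "n < D ^ k"
  shows "c n = 0"
  using assms
proof (induction k arbitrary: c n)
  case 0
  show ?case
  proof (rule ccontr)
    \<comment> \<open>As \<open>D ^ 0 = 1\<close>, the whole sum is the constant \<open>c 0\<close>;
      if nonzero, it would be a unit in a prime ideal.\<close>
    assume c: "c n \<noteq> 0"
    have "n = 0"
      using 0 by simp
    have "Poly_Mapping.single 0 (c 0) \<in> R 0"
      using 0 by simp
    moreover have R: "ideal (R 0) ring_of_type_algebra" "1 \<notin> R 0"
      using 0(1)[of 0] by (simp_all add: primeideal_type_algebra_iff)
    ultimately have "Poly_Mapping.single 0 (inverse (c 0)) * Poly_Mapping.single 0 (c 0) \<in> R 0"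
      unfolding ideal_type_algebra_iff by blast
    then show False
      using R c \<open>n = 0\<close> by (simp add: mult_single)
  qed
next
  case (Suc k)
  \<comment> \<open>Grouping the indices by their leading digit \<open>t\<close> turns the sum into
    a polynomial in \<open>g k\<close> with coefficients \<open>h t\<close>.\<close>
  define h where "h t = (\<Sum>n<D ^ k. Poly_Mapping.single 0 (c (t * D ^ k + n)) * digit_product D g k n)" for t
  have coeff: "\<forall>n<D ^ k. c (t * D ^ k + n) = 0" if "h t \<in> R k" for t
    using Suc.IH[of "\<lambda>n. c (t * D ^ k + n)"] Suc.prems(1,2) that by (simp add: h_def)
  have "(\<Sum>n<D ^ Suc k. Poly_Mapping.single 0 (c n) * digit_product D g (Suc k) n) =
      (\<Sum>t<D. \<Sum>n\<in>{t * D ^ k..<t * D ^ k + D ^ k}. Poly_Mapping.single 0 (c n) * digit_product D g (Suc k) n)"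
    by (simp only: sum.nat_group power_Suc)
  also have "\<dots> = (\<Sum>t<D. \<Sum>n<D ^ k. Poly_Mapping.single 0 (c (t * D ^ k + n)) * digit_product D g (Suc k) (t * D ^ k + n))"
  proof (rule sum.cong[OF refl])
    fix t
    show "(\<Sum>n\<in>{t * D ^ k..<t * D ^ k + D ^ k}. Poly_Mapping.single 0 (c n) * digit_product D g (Suc k) n) =
      (\<Sum>n<D ^ k. Poly_Mapping.single 0 (c (t * D ^ k + n)) * digit_product D g (Suc k) (t * D ^ k + n))"
      using sum.shift_bounds_nat_ivl[of "\<lambda>n. Poly_Mapping.single 0 (c n) * digit_product D g (Suc k) n" 0 "t * D ^ k" "D ^ k"]
      by (simp add: atLeast0LessThan add.commute del: digit_product.simps)
  qed
  also have "\<dots> = (\<Sum>t<D. g k ^ t * h t)"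
    unfolding h_def sum_distrib_left
    by (intro sum.cong refl) (simp add: algebra_simps)
  finally have "(\<Sum>t<D. g k ^ t * h t) \<in> R (Suc k)"
    using Suc.prems(3) by simp
  moreover have "h t = 0" if "h t \<in> R k" for t
    using coeff[OF that] by (simp add: h_def)
  moreover have "primeideal (R (Suc k)) ring_of_type_algebra" "primeideal (R k) ring_of_type_algebra"
    using Suc.prems(1) by simp_all
  ultimately have h: "h t = 0" if "t < D" for t
    using that Suc.prems(2)[of k]
    by (intro poly_combination_eq_zero[of "R (Suc k)" "R k" "g k" D h t])
      (auto simp: primeideal_type_algebra_iff)
  have "D ^ k > 0"
    using Suc.prems(4) by (cases "D = 0") auto
  then have "n div D ^ k < D" "n mod D ^ k < D ^ k"
    using Suc.prems(4) by (simp_all add: less_mult_imp_div_less)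
  \<comment> \<open>The vanishing \<open>h t\<close> thus lie in \<open>R k\<close>, which is what
    \<open>coeff\<close> asks for.\<close>
  moreover have "0 \<in> R k"
    using Suc.prems(1)[of k] by (simp add: primeideal_type_algebra_iff ideal_type_algebra_iff)
  ultimately show ?case
    using coeff[of "n div D ^ k"] h by (metis div_mult_mod_eq)
qed

section \<open>Counting monomials of bounded exponents\<close>

definition exponents_le :: "nat \<Rightarrow> ('v \<Rightarrow>\<^sub>0 nat) set" where
  "exponents_le M = {m. \<forall>v. Poly_Mapping.lookup m v \<le> M}"

lemma exponents_le_mono: "M \<le> N \<Longrightarrow> exponents_le M \<subseteq> exponents_le N"
  by (auto simp: exponents_le_def intro: order_trans)

lemma finite_card_exponents_le:
  "finite (exponents_le M :: ('v::finite \<Rightarrow>\<^sub>0 nat) set) \<and>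
    card (exponents_le M :: ('v \<Rightarrow>\<^sub>0 nat) set) \<le> (M + 1) ^ card (UNIV :: 'v set)"
proof -
  let ?F = "PiE UNIV (\<lambda>_ :: 'v. {..M})"
  have fin: "finite ?F"
    by (intro finite_PiE) auto
  have inj: "inj_on Poly_Mapping.lookup (exponents_le M :: ('v \<Rightarrow>\<^sub>0 nat) set)"
    by (auto intro: inj_onI poly_mapping_eqI)
  have sub: "Poly_Mapping.lookup ` (exponents_le M :: ('v \<Rightarrow>\<^sub>0 nat) set) \<subseteq> ?F"
    by (auto simp: exponents_le_def)
  have "card ?F = (M + 1) ^ card (UNIV :: 'v set)"
    by (simp add: card_PiE)
  then show ?thesis
    using card_inj_on_le[OF inj sub fin] inj_on_finite[OF inj sub fin] by simp
qed

lemma keys_mult_exponents_le: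
  assumes "Poly_Mapping.keys p \<subseteq> exponents_le M" and "Poly_Mapping.keys q \<subseteq> exponents_le N"
  shows "Poly_Mapping.keys (p * q) \<subseteq> exponents_le (M + N)"
proof
  fix m assume "m \<in> Poly_Mapping.keys (p * q)"
  then obtain a b where "a \<in> Poly_Mapping.keys p" "b \<in> Poly_Mapping.keys q" "m = a + b"
    using keys_mult[of p q] by blast
  then show "m \<in> exponents_le (M + N)"
    using assms by (auto simp: exponents_le_def lookup_add intro!: add_mono)
qed

lemma keys_one_exponents_le: "Poly_Mapping.keys 1 \<subseteq> exponents_le M"
  by (simp add: exponents_le_def)

lemma keys_power_exponents_le:
  assumes "Poly_Mapping.keys p \<subseteq> exponents_le M"
  shows "Poly_Mapping.keys (p ^ t) \<subseteq> exponents_le (t * M)"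
proof (induction t)
  case (Suc t)
  then show ?case
    using keys_mult_exponents_le[OF assms] by simp
qed (simp add: keys_one_exponents_le del: keys_one)

text \<open>Each of the \<open>k\<close> factors is a power with exponent below \<open>D\<close>, so
  it adds at most \<open>D * M\<close> to the bound.\<close>

lemma keys_digit_product_exponents_le:
  assumes "\<And>i. i < k \<Longrightarrow> Poly_Mapping.keys (g i) \<subseteq> exponents_le M" and "n < D ^ k"
  shows "Poly_Mapping.keys (digit_product D g k n) \<subseteq> exponents_le (k * D * M)"
  using assms
proof (induction k arbitrary: n)
  case 0
  show ?case
    by (simp add: keys_one_exponents_le del: keys_one)
next
  case (Suc k)
  have "D ^ k > 0"
    using Suc.prems(2) by (cases "D = 0") auto
  then have lt: "n div D ^ k < D" "n mod D ^ k < D ^ k"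
    using Suc.prems(2) by (simp_all add: less_mult_imp_div_less)
  have "Poly_Mapping.keys (digit_product D g (Suc k) n) \<subseteq> exponents_le (n div D ^ k * M + k * D * M)"
    using keys_mult_exponents_le[OF keys_power_exponents_le[OF Suc.prems(1)] Suc.IH[OF Suc.prems(1) lt(2)]]
    by simp
  also have "\<dots> \<subseteq> exponents_le (Suc k * D * M)"
    using lt(1) by (intro exponents_le_mono) (simp add: algebra_simps add_mono mult_le_mono)
  finally show ?case .
qed

lemma exists_exponents_le:
  fixes p :: "('v, 'k::zero) mpolynomial"
  shows "\<exists>M. Poly_Mapping.keys p \<subseteq> exponents_le M"
proof -
  let ?X = "\<Union>m\<in>Poly_Mapping.keys p. Poly_Mapping.lookup m ` Poly_Mapping.keys m"
  have "Poly_Mapping.keys p \<subseteq> exponents_le (Max (insert 0 ?X))"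
    unfolding exponents_le_def
  proof (intro subsetI CollectI allI)
    fix m v assume "m \<in> Poly_Mapping.keys p"
    then have "Poly_Mapping.lookup m v \<in> insert 0 ?X"
      by (cases "v \<in> Poly_Mapping.keys m") (auto simp: not_in_keys_iff_lookup_eq_zero simp del: lookup_not_eq_zero_eq_in_keys)
    then show "Poly_Mapping.lookup m v \<le> Max (insert 0 ?X)"
      by (intro Max_ge) auto
  qed
  then show ?thesis
    by blast
qed

lemma prime_chain_length_le:
  fixes R :: "nat \<Rightarrow> ('v::finite, 'k::field) mpolynomial set"
  assumes prime: "\<And>i. i \<le> k \<Longrightarrow> primeideal (R i) ring_of_type_algebra"
    and chain: "\<And>i. i < k \<Longrightarrow> R (Suc i) \<subset> R i"
  shows "k \<le> card (UNIV :: 'v set)"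
proof (rule ccontr)
  assume k: "\<not> k \<le> card (UNIV :: 'v set)"
  have "\<exists>p. p \<in> R i \<and> p \<notin> R (Suc i)" if "i < k" for i
    using chain[OF that] by blast
  then obtain g where g: "\<And>i. i < k \<Longrightarrow> g i \<in> R i \<and> g i \<notin> R (Suc i)"
    by metis
  have "\<forall>i. \<exists>M. Poly_Mapping.keys (g i) \<subseteq> exponents_le M"
    using exists_exponents_le by blast
  then obtain B where B: "\<And>i. Poly_Mapping.keys (g i) \<subseteq> exponents_le (B i)"
    by metis
  define M where "M = (\<Sum>i<k. B i)"
  have M: "Poly_Mapping.keys (g i) \<subseteq> exponents_le M" if "i < k" for i
    using B[of i] exponents_le_mono[of "B i" M] that
    by (force simp: M_def intro: member_le_sum)
  define N where "N = card (UNIV :: 'v set)"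
  \<comment> \<open>With this choice the box of exponents has at most \<open>D ^ N * (D - 1)\<close>
    elements, fewer than \<open>D ^ Suc N\<close>, whereas \<open>k > N\<close> gives at least that
    many independent digit products.\<close>
  define D where "D = (k * M + 1) ^ N + 1"
  have "D ^ k \<le> card (exponents_le (k * D * M) :: ('v \<Rightarrow>\<^sub>0 nat) set)"
  proof (rule card_le_of_independent_family)
    fix c :: "nat \<Rightarrow> 'k" and i
    assume *: "(\<Sum>j<D ^ k. Poly_Mapping.single 0 (c j) * digit_product D g k j) = 0" "i < D ^ k"
    have "0 \<in> R k"
      using prime[of k] by (simp add: primeideal_type_algebra_iff ideal_type_algebra_iff)
    then show "c i = 0"
      using * prime chain g by (intro digit_products_independent[where k = k and R = R and g = g and D = D]) auto
  qed (use finite_card_exponents_le keys_digit_product_exponents_le M in blast)+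
  also have "\<dots> \<le> (k * D * M + 1) ^ N"
    using finite_card_exponents_le unfolding N_def by blast
  also have "\<dots> \<le> (D * (k * M + 1)) ^ N"
    by (intro power_mono) (simp_all add: D_def algebra_simps)
  also have "\<dots> = D ^ N * (D - 1)"
    unfolding power_mult_distrib by (simp add: D_def)
  also have "\<dots> < D ^ Suc N"
    by (simp add: D_def)
  also have "\<dots> \<le> D ^ k"
    using k by (intro power_increasing) (simp_all add: N_def D_def)
  finally show False
    by simp
qed

section \<open>Chains of variable primes\<close>

lemma var_prime_subset_iff:
  "(var_prime C :: ('v, 'k::field) mpolynomial set) \<subseteq> var_prime D \<longleftrightarrow> C \<subseteq> D"
proof
  assume sub: "(var_prime C :: ('v, 'k) mpolynomial set) \<subseteq> var_prime D"
  show "C \<subseteq> D"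
  proof
    fix v assume "v \<in> C"
    then have "Poly_Mapping.single (Poly_Mapping.single v 1) 1 \<in> (var_prime C :: ('v, 'k) mpolynomial set)"
      by (simp add: var_prime_def)
    then have "Poly_Mapping.single (Poly_Mapping.single v 1) 1 \<in> (var_prime D :: ('v, 'k) mpolynomial set)"
      using sub by blast
    then show "v \<in> D"
      by (simp add: var_prime_def)
  qed
qed (auto simp: var_prime_def)

lemma var_prime_psubset_iff:
  "(var_prime C :: ('v, 'k::field) mpolynomial set) \<subset> var_prime D \<longleftrightarrow> C \<subset> D"
  by (simp add: less_le_not_le var_prime_subset_iff)

text \<open>Elements of \<open>B - A\<close> are added one at a time. Such chains serve both below a
  set, from the empty set, and above it, up to \<open>UNIV\<close>.\<close>

lemma exists_full_chain:
  fixes A B :: "'v::finite set"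
  assumes "A \<subseteq> B"
  shows "\<exists>C. C 0 = A \<and> C (card B - card A) = B \<and> (\<forall>i < card B - card A. C i \<subset> C (Suc i))"
  using finite[of B] assms
proof (induction B rule: finite_remove_induct)
  case empty
  then show ?case
    by auto
next
  case (remove B)
  show ?case
  proof (cases "A = B")
    case False
    then obtain x where x: "x \<in> B" "x \<notin> A"
      using remove.prems by blast
    then obtain C where C: "C 0 = A" "C (card (B - {x}) - card A) = B - {x}"
      "\<forall>i < card (B - {x}) - card A. C i \<subset> C (Suc i)"
      using remove.IH[of x] remove.prems by blast
    have "card A \<le> card (B - {x})"
      using x remove.prems by (intro card_mono) auto
    moreover have "card B = Suc (card (B - {x}))"
      using x by (intro card.remove) auto
    ultimately have eq: "card B - card A = Suc (card (B - {x}) - card A)"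
      by simp
    have "\<forall>i < card B - card A. (C(card B - card A := B)) i \<subset> (C(card B - card A := B)) (Suc i)"
      using C x unfolding eq by (auto simp: less_Suc_eq)
    then show ?thesis
      using C eq by (intro exI[of _ "C(card B - card A := B)"]) auto
  qed auto
qed

text \<open>Adding the variables of \<open>C\<close> one by one gives the lower bound. For the upper
  bound, any chain ending in \<open>var_prime C\<close> is prolonged by adding the variables outside
  \<open>C\<close>, and the total length is at most the number of variables.\<close>

lemma prime_height_var_prime:
  fixes C :: "'v::finite set"
  shows "prime_height ring_of_type_algebra (var_prime C :: ('v, 'k::field) mpolynomial set) = enat (card C)"
proof -
  let ?chain = "\<lambda>k (Q :: nat \<Rightarrow> ('v, 'k) mpolynomial set).
    (\<forall>i\<le>k. primeideal (Q i) ring_of_type_algebra) \<and> (\<forall>i<k. Q i \<subset> Q (Suc i)) \<and> Q k = var_prime C"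
  have "k \<le> card C" if Q: "?chain k Q" for k Q
  proof -
    have card: "card C \<le> card (UNIV :: 'v set)"
      by (rule card_mono) auto
    define n where "n = card (UNIV :: 'v set) - card C"
    obtain U where U: "U 0 = C" "\<forall>i < n. U i \<subset> U (Suc i)"
      using exists_full_chain[of C UNIV] by (auto simp: n_def)
    \<comment> \<open>The prolonged chain is read downwards: first from the top to
      \<open>var_prime C\<close> at index \<open>n\<close>, then along \<open>Q\<close>. The two
      pieces share \<open>Q k = var_prime C\<close>, so the length is \<open>n + k\<close>.\<close>
    define S where "S i = (if i \<le> n then var_prime (U (n - i)) else Q (k - (i - n)))" for i
    have "n + k \<le> card (UNIV :: 'v set)"
    proof (rule prime_chain_length_le[of _ S])
      show "primeideal (S i) ring_of_type_algebra" if "i \<le> n + k" for i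
        using Q by (auto simp: S_def primeideal_var_prime)
      show "S (Suc i) \<subset> S i" if "i < n + k" for i
      proof -
        consider "i < n" | "i = n" | "i > n"
          by linarith
        then show ?thesis
        proof cases
          case 1
          then have "n - i = Suc (n - Suc i)"
            by simp
          then show ?thesis
            using 1 U(2) by (auto simp: S_def var_prime_psubset_iff)
        next
          case 2
          then have "S i = Q k" "S (Suc i) = Q (k - 1)" "k - 1 < k"
            using U Q that by (auto simp: S_def)
          then show ?thesis
            using Q by (metis Suc_diff_1 gr_implies_not0 not_gr_zero)
        next
          case 3
          then have "S i = Q (Suc (k - (Suc i - n)))" "S (Suc i) = Q (k - (Suc i - n))" "k - (Suc i - n) < k"
            using that by (auto simp: S_def Suc_diff_le intro!: arg_cong[of _ _ Q])
          then show ?thesis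
            using Q by metis
        qed
      qed
    qed
    then show ?thesis
      using card by (simp add: n_def)
  qed
  moreover have "\<exists>Q. ?chain (card C) Q"
  proof -
    obtain U where "U (card C) = C" "\<forall>i < card C. U i \<subset> U (Suc i)"
      using exists_full_chain[of "{}" C] by auto
    then show ?thesis
      by (intro exI[of _ "\<lambda>i. var_prime (U i)"]) (simp add: primeideal_var_prime var_prime_psubset_iff)
  qed
  ultimately show ?thesis
    unfolding prime_height_def by (intro antisym Sup_least Sup_upper) auto
qed

section \<open>Squarefree monomial ideals\<close>

definition transversal :: "'v set set \<Rightarrow> 'v set \<Rightarrow> bool" where
  "transversal E C \<longleftrightarrow> (\<forall>e\<in>E. e \<inter> C \<noteq> {})"

definition minimal_transversal :: "'v set set \<Rightarrow> 'v set \<Rightarrow> bool" where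
  "minimal_transversal E C \<longleftrightarrow> transversal E C \<and> (\<forall>D. transversal E D \<and> D \<subseteq> C \<longrightarrow> D = C)"

lemma exists_minimal_transversal:
  fixes C :: "'v::finite set"
  assumes "transversal E C"
  shows "\<exists>D\<subseteq>C. minimal_transversal E D"
  using finite_has_minimal2[of "{D. transversal E D}" C] assms
  unfolding minimal_transversal_def by (simp add: finite) blast

text \<open>If the support of a monomial contains no edge, its complement is a transversal, and the
  monomial lies outside the corresponding prime.\<close>

lemma edge_ideal_eq_INT:
  "(edge_ideal E :: ('v, 'k::field) mpolynomial set) = (\<Inter>C\<in>{C. transversal E C}. var_prime C)"
proof (intro antisym subsetI)
  fix p :: "('v, 'k) mpolynomial"
  assume p: "p \<in> (\<Inter>C\<in>{C. transversal E C}. var_prime C)"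
  have "\<exists>e\<in>E. e \<subseteq> Poly_Mapping.keys m" if "m \<in> Poly_Mapping.keys p" for m
  proof (rule ccontr)
    assume "\<not> ?thesis"
    then have "transversal E (- Poly_Mapping.keys m)"
      by (auto simp: transversal_def)
    then show False
      using p that by (auto simp: var_prime_def)
  qed
  then show "p \<in> edge_ideal E"
    by (simp add: edge_ideal_def)
next
  fix p :: "('v, 'k) mpolynomial"
  assume "p \<in> edge_ideal E"
  then show "p \<in> (\<Inter>C\<in>{C. transversal E C}. var_prime C)"
    unfolding edge_ideal_def var_prime_def transversal_def by fastforce
qed

lemma lookup_sum_single_eq:
  assumes "finite A"
  shows "Poly_Mapping.lookup (\<Sum>v\<in>A. Poly_Mapping.single v (c::nat)) w = (if w \<in> A then c else 0)"
  using assms by (simp add: lookup_sum lookup_single when_def)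

lemma keys_sum_single:
  assumes "finite A"
  shows "Poly_Mapping.keys (\<Sum>v\<in>A. Poly_Mapping.single v (1::nat)) = A"
  using assms by (auto simp: in_keys_iff lookup_sum_single_eq split: if_splits)

lemma mult_mem_var_prime_iff:
  fixes C :: "'v::finite set" and p q :: "('v, 'k::field) mpolynomial"
  shows "p * q \<in> var_prime C \<longleftrightarrow> p \<in> var_prime C \<or> q \<in> var_prime C"
proof
  show "p * q \<in> var_prime C" if "p \<in> var_prime C \<or> q \<in> var_prime C"
    using that ideal_var_prime[of C, where 'k = 'k]
    unfolding ideal_type_algebra_iff by (metis mult.commute)
qed (use primeideal_var_prime[of C, where 'k = 'k] in \<open>simp add: primeideal_type_algebra_iff\<close>)

text \<open>A colon ideal of the edge ideal is a finite intersection of variable primes; if it is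
  prime, it equals one of them. Conversely, a squarefree monomial isolates the prime of a given
  minimal transversal.\<close>

lemma associated_primes_edge_ideal:
  fixes E :: "'v::finite set set"
  shows "associated_primes ring_of_type_algebra (edge_ideal E :: ('v, 'k::field) mpolynomial set) =
    var_prime ` {C. minimal_transversal E C}"
proof (intro antisym subsetI)
  fix P :: "('v, 'k) mpolynomial set"
  assume "P \<in> associated_primes ring_of_type_algebra (edge_ideal E)"
  then obtain f where P: "primeideal P ring_of_type_algebra" and f: "P = {r. r * f \<in> edge_ideal E}"
    by (auto simp: associated_primes_def ring_of_type_algebra_def)
  define A where "A = {C. transversal E C \<and> f \<notin> var_prime C}"
  \<comment> \<open>Dividing by \<open>f\<close> turns a variable prime containing \<open>f\<close>
    into the whole ring and leaves the others unchanged.\<close>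
  have P_eq: "P = (\<Inter>C\<in>A. var_prime C)"
    unfolding f edge_ideal_eq_INT A_def by (auto simp: mult_mem_var_prime_iff)
  obtain C where C: "C \<in> A" "var_prime C \<subseteq> P"
    using primeideal_INT_subset[OF P, of A var_prime] P_eq ideal_var_prime by (auto simp: finite)
  then have "P = var_prime C"
    using P_eq by blast
  moreover have "minimal_transversal E C"
    unfolding minimal_transversal_def
  proof (intro conjI allI impI)
    show "transversal E C"
      using C by (simp add: A_def)
    fix D assume D: "transversal E D \<and> D \<subseteq> C"
    then have "D \<in> A"
      using C var_prime_subset_iff[of D C, where 'k = 'k] by (auto simp: A_def)
    then have "(var_prime C :: ('v, 'k) mpolynomial set) \<subseteq> var_prime D"
      using P_eq C(2) by blast
    then show "D = C"
      using D by (simp add: var_prime_subset_iff)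
  qed
  ultimately show "P \<in> var_prime ` {C. minimal_transversal E C}"
    by blast
next
  fix P :: "('v, 'k) mpolynomial set"
  assume "P \<in> var_prime ` {C. minimal_transversal E C}"
  then obtain C where C: "minimal_transversal E C" and P: "P = var_prime C"
    by blast
  \<comment> \<open>The product of all variables outside \<open>C\<close> lies in the prime of every
    transversal except \<open>C\<close> itself, by minimality of \<open>C\<close>.\<close>
  define m where "m = (\<Sum>v\<in>- C. Poly_Mapping.single v (1::nat))"
  have keys_m: "Poly_Mapping.keys m = - C"
    by (simp add: m_def keys_sum_single del: One_nat_def)
  define f :: "('v, 'k) mpolynomial" where "f = Poly_Mapping.single m 1"
  have f: "f \<in> var_prime D \<longleftrightarrow> \<not> D \<subseteq> C" for D
    by (auto simp: f_def var_prime_def keys_m)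
  have "r * f \<in> edge_ideal E \<longleftrightarrow> r \<in> var_prime C" for r
    unfolding edge_ideal_eq_INT using C f by (auto simp: mult_mem_var_prime_iff minimal_transversal_def)
  then show "P \<in> associated_primes ring_of_type_algebra (edge_ideal E)"
    using primeideal_var_prime[of C, where 'k = 'k]
    by (auto simp: associated_primes_def ring_of_type_algebra_def P)
qed

lemma unmixed_edge_ideal_iff:
  fixes E :: "'v::finite set set"
  shows "unmixed ring_of_type_algebra (edge_ideal E :: ('v, 'k::field) mpolynomial set) \<longleftrightarrow>
    (\<forall>C D. minimal_transversal E C \<and> minimal_transversal E D \<longrightarrow> card C = card D)"
  unfolding unmixed_def associated_primes_edge_ideal by (auto simp: prime_height_var_prime)

section \<open>Transversals of the graphs of weak homomorphisms\<close>

text \<open>These index pairs are the variables occurring in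
  \<open>whom_monomial \<phi>\<close>.\<close>

definition graph_of :: "('a \<Rightarrow> 'b) \<Rightarrow> ('a \<times> 'b) set" where
  "graph_of \<phi> = range (\<lambda>i. (i, \<phi> i))"

lemma whom_monomial_eq_single:
  "(whom_monomial \<phi> :: ('a::finite, 'b, 'k::field) xpoly) =
    Poly_Mapping.single (\<Sum>v\<in>graph_of \<phi>. Poly_Mapping.single v 1) 1"
proof -
  have "(\<Prod>i\<in>A. xvar i (\<phi> i) :: ('a, 'b, 'k) xpoly) =
      Poly_Mapping.single (\<Sum>i\<in>A. Poly_Mapping.single (i, \<phi> i) 1) 1" for A
    by (induction A rule: infinite_finite_induct) (simp_all add: xvar_def mult_single)
  then show ?thesis
    by (simp add: whom_monomial_def graph_of_def sum.reindex inj_on_def)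
qed

lemma whom_ideal_eq_edge_ideal:
  fixes G :: "'a::finite set set" and H :: "'b::finite set set"
  shows "(whom_ideal G H :: ('a, 'b, 'k::field) xpoly set) = edge_ideal (graph_of ` WHom G H)"
    (is "?I = edge_ideal ?E")
proof
  interpret R: cring "ring_of_type_algebra :: ('a, 'b, 'k) xpoly ring"
    by (rule cring_from_type_algebra)
  have carrier: "whom_monomial ` WHom G H \<subseteq> carrier (ring_of_type_algebra :: ('a, 'b, 'k) xpoly ring)"
    by (simp add: ring_of_type_algebra_def)
  have "whom_monomial ` WHom G H \<subseteq> (edge_ideal ?E :: ('a, 'b, 'k) xpoly set)"
    by (auto simp: edge_ideal_def whom_monomial_eq_single keys_sum_single simp del: One_nat_def)
  then show "?I \<subseteq> edge_ideal ?E"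
    unfolding whom_ideal_def by (intro R.genideal_minimal ideal_edge_ideal)
  have I: "ideal ?I ring_of_type_algebra"
    unfolding whom_ideal_def by (rule R.genideal_ideal[OF carrier])
  show "edge_ideal ?E \<subseteq> ?I"
  proof
    fix p :: "('a, 'b, 'k) xpoly" assume p: "p \<in> edge_ideal ?E"
    have "Poly_Mapping.single m (Poly_Mapping.lookup p m) \<in> ?I" if m: "m \<in> Poly_Mapping.keys p" for m
    proof -
      obtain \<phi> where \<phi>: "\<phi> \<in> WHom G H" "graph_of \<phi> \<subseteq> Poly_Mapping.keys m"
        using p m unfolding edge_ideal_def by blast
      let ?u = "\<Sum>v\<in>graph_of \<phi>. Poly_Mapping.single v (1::nat)"
      \<comment> \<open>Subtraction of exponents is truncated, but \<open>m\<close> is at least 1 on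
        the graph of \<open>\<phi>\<close>, so the division by \<open>whom_monomial \<phi>\<close>
        is exact.\<close>
      have "m = (m - ?u) + ?u"
        using \<phi>(2) by (intro poly_mapping_eqI)
          (auto simp: lookup_add lookup_minus lookup_sum_single_eq in_keys_iff subset_iff Suc_le_eq)
      then have "Poly_Mapping.single m (Poly_Mapping.lookup p m) =
          Poly_Mapping.single (m - ?u) (Poly_Mapping.lookup p m) * whom_monomial \<phi>"
        by (simp add: whom_monomial_eq_single mult_single)
      moreover have "whom_monomial \<phi> \<in> ?I"
        using R.genideal_self[OF carrier] \<phi>(1) by (auto simp: whom_ideal_def)
      ultimately show ?thesis
        using I by (simp add: ideal_type_algebra_iff)
    qed
    then show "p \<in> ?I"
      using polynomial_eq_sum_terms[of p] ideal_sum_closed[OF I] by metis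
  qed
qed

lemma transversal_graphs_iff:
  "transversal (graph_of ` F) T \<longleftrightarrow> (\<forall>\<phi>\<in>F. \<exists>i. (i, \<phi> i) \<in> T)"
  by (auto simp: transversal_def graph_of_def)

lemma const_in_WHom: "(\<lambda>_. j) \<in> WHom G H"
  by (simp add: WHom_def)

lemma transversal_row: "transversal (graph_of ` F) ({i} \<times> UNIV)"
  by (auto simp: transversal_graphs_iff)

lemma minimal_transversal_row: "minimal_transversal (graph_of ` WHom G H) ({i} \<times> UNIV)"
  unfolding minimal_transversal_def
proof (intro conjI allI impI transversal_row)
  fix D assume D: "transversal (graph_of ` WHom G H) D \<and> D \<subseteq> {i} \<times> UNIV"
  then have "\<exists>i. (i, j) \<in> D" for j
    using const_in_WHom[of j G H] unfolding transversal_graphs_iff by fast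
  then show "D = {i} \<times> UNIV"
    using D by blast
qed

section \<open>Necessity: a minimal transversal larger than a row\<close>

text \<open>If \<open>a - b - c\<close> is an induced path of \<open>H\<close> and \<open>{p, q}\<close> an edge of \<open>G\<close>, then sending
  \<open>p\<close> to \<open>a\<close>, \<open>q\<close> to \<open>c\<close> and all other vertices to \<open>b\<close> is not a weak homomorphism, but it
  becomes one after redirecting either \<open>p\<close> or \<open>q\<close> to \<open>b\<close>. A minimal transversal avoiding this
  map therefore contains both \<open>(p, b)\<close> and \<open>(q, b)\<close>, besides an element of every other column.\<close>

lemma exists_large_minimal_transversal:
  fixes G :: "'a::finite set set" and H :: "'b::finite set set"
  assumes pq: "{p, q} \<in> G" "p \<noteq> q"
    and ab: "{a, b} \<in> H" and bc: "{b, c} \<in> H" and ac: "{a, c} \<notin> H" "a \<noteq> c"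
  shows "\<exists>T. minimal_transversal (graph_of ` WHom G H) T \<and> card (UNIV :: 'b set) < card T"
proof -
  define \<psi> where "\<psi> = (\<lambda>_. b)(p := a, q := c)"
  have "transversal (graph_of ` WHom G H) (- graph_of \<psi>)"
    unfolding transversal_graphs_iff
  proof (rule ballI, rule ccontr)
    fix \<phi> assume \<phi>: "\<phi> \<in> WHom G H" "\<nexists>i. (i, \<phi> i) \<in> - graph_of \<psi>"
    then have "\<phi> = \<psi>"
      by (auto simp: graph_of_def)
    moreover have "\<phi> p = \<phi> q \<or> {\<phi> p, \<phi> q} \<in> H"
      using \<phi>(1) pq(1) unfolding WHom_def by blast
    ultimately show False
      using pq(2) ac by (simp add: \<psi>_def)
  qed
  then obtain T where T: "T \<subseteq> - graph_of \<psi>" "minimal_transversal (graph_of ` WHom G H) T"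
    using exists_minimal_transversal by blast
  then have hit: "\<exists>i. (i, \<phi> i) \<in> T" if "\<phi> \<in> WHom G H" for \<phi>
    using that by (auto simp: minimal_transversal_def transversal_graphs_iff)
  have avoid: "(i, \<psi> i) \<notin> T" for i
    using T(1) by (auto simp: graph_of_def)
  have "\<psi>(p := b) \<in> WHom G H" "\<psi>(q := b) \<in> WHom G H"
    using ab bc pq(2) by (auto simp: WHom_def \<psi>_def insert_commute)
  \<comment> \<open>Each redirected map differs from \<open>\<psi>\<close> at one vertex only, and
    \<open>T\<close> avoids the graph of \<open>\<psi>\<close>, so \<open>T\<close> meets its graph
    at that vertex.\<close>
  then have pb: "(p, b) \<in> T" and qb: "(q, b) \<in> T"
    using hit avoid by (metis fun_upd_apply)+
  \<comment> \<open>Without \<open>(p, b)\<close> all columns are still met, since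
    \<open>(q, b)\<close> serves column \<open>b\<close>; hence \<open>T\<close> has one element
    more than there are columns.\<close>
  have "j \<in> snd ` (T - {(p, b)})" for j
  proof (cases "j = b")
    case True
    then show ?thesis
      using qb pq(2) by (intro image_eqI[of _ _ "(q, b)"]) auto
  next
    case False
    then show ?thesis
      using hit[OF const_in_WHom[of j]] by (auto intro: image_eqI[of _ _ "(_, j)"])
  qed
  then have "snd ` (T - {(p, b)}) = UNIV"
    by blast
  then have "card (UNIV :: 'b set) \<le> card (T - {(p, b)})"
    using card_image_le[of "T - {(p, b)}" snd] by simp
  also have "\<dots> < card T"
    using pb by (intro card_Diff1_less) auto
  finally have "card (UNIV :: 'b set) < card T" .
  then show ?thesis
    using T(2) by blast
qed

text \<open>Without an induced path, being equal or adjacent is transitive, and the classes of this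
  equivalence are the cliques.\<close>

lemma exists_induced_path:
  assumes H: "simple_graph H" and "\<not> disjoint_union_of_complete_graphs H"
  shows "\<exists>a b c. {a, b} \<in> H \<and> {b, c} \<in> H \<and> {a, c} \<notin> H \<and> a \<noteq> c"
proof (rule ccontr)
  assume no_path: "\<not> ?thesis"
  define r where "r = {(x, y). x = y \<or> {x, y} \<in> H}"
  have comm: "{x, y} \<in> H \<longleftrightarrow> {y, x} \<in> H" for x y
    by (simp add: insert_commute)
  have "refl r" "sym r" "trans r"
    using no_path comm by (auto simp: r_def refl_on_def sym_def trans_def)
  then have r: "equiv UNIV r"
    by (simp add: equiv_def)
  have neq: "x \<noteq> y" if "{x, y} \<in> H" for x y
    using H that by (auto simp: simple_graph_def)
  have "(\<exists>C\<in>UNIV // r. x \<in> C \<and> y \<in> C) \<longleftrightarrow> (x, y) \<in> r" for x y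
    using r by (metis Image_singleton_iff UNIV_I equiv_class_self in_quotient_imp_in_rel empty_subsetI insert_subset quotientI)
  then have "{{x, y} |x y. x \<noteq> y \<and> (\<exists>C\<in>UNIV // r. x \<in> C \<and> y \<in> C)} = {{x, y} |x y. x \<noteq> y \<and> {x, y} \<in> H}"
    by (auto simp: r_def)
  also have "\<dots> = H"
  proof (intro antisym subsetI)
    fix e assume "e \<in> H"
    moreover from this obtain x y where "e = {x, y}" "x \<noteq> y"
      using H by (auto simp: simple_graph_def card_2_iff)
    ultimately show "e \<in> {{x, y} |x y. x \<noteq> y \<and> {x, y} \<in> H}"
      by blast
  qed auto
  finally have "H = {{x, y} |x y. x \<noteq> y \<and> (\<exists>C\<in>UNIV // r. x \<in> C \<and> y \<in> C)}"
    by (rule sym)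
  then have "disjoint_union_of_complete_graphs H"
    unfolding disjoint_union_of_complete_graphs_def
    by (intro exI[of _ "UNIV // r"] conjI partition_on_quotient r)
  then show False
    using assms(2) by blast
qed

section \<open>Sufficiency: all minimal transversals are as large as a row\<close>

text \<open>Every map is a weak homomorphism here. If each row had a point outside \<open>T\<close>,
  choosing these points would give a map avoiding \<open>T\<close>; so \<open>T\<close> contains a
  row, and equals it by minimality.\<close>

lemma card_minimal_transversal_totally_disconnected:
  fixes T :: "('a::finite \<times> 'b::finite) set"
  assumes "minimal_transversal (graph_of ` WHom {} H) T"
  shows "card T = card (UNIV :: 'b set)"
proof -
  have T: "\<exists>i. (i, \<phi> i) \<in> T" for \<phi>
    using assms by (auto simp: minimal_transversal_def transversal_graphs_iff WHom_def)
  have "\<exists>i. \<forall>j. (i, j) \<in> T"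
    using T by metis
  then obtain i where "{i} \<times> UNIV \<subseteq> T"
    by auto
  then have "T = {i} \<times> UNIV"
    using assms transversal_row by (metis minimal_transversal_def)
  then show ?thesis
    by (simp add: card_cartesian_product)
qed

text \<open>A minimal transversal consists of one fibre \<open>{i} \<times> C\<close> for each clique \<open>C\<close> of \<open>H\<close>, where
  all the vertices \<open>i\<close> lie in the same component of \<open>G\<close>.\<close>

lemma card_minimal_transversal_cliques:
  fixes T :: "('a::finite \<times> 'b::finite) set"
  assumes H: "disjoint_union_of_complete_graphs H"
    and T: "minimal_transversal (graph_of ` WHom G H) T"
  shows "card T = card (UNIV :: 'b set)"
proof -
  obtain P where P: "partition_on UNIV P"
    and H_eq: "H = {{x, y} |x y. x \<noteq> y \<and> (\<exists>C\<in>P. x \<in> C \<and> y \<in> C)}"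
    using H by (auto simp: disjoint_union_of_complete_graphs_def)
  have edge: "x = y \<or> {x, y} \<in> H \<longleftrightarrow> (\<exists>C\<in>P. x \<in> C \<and> y \<in> C)" for x y
    using P by (auto simp: H_eq doubleton_eq_iff partition_on_def)
  have unique: "C = D" if "C \<in> P" "D \<in> P" "x \<in> C" "x \<in> D" for C D x
    using P that unfolding partition_on_def disjoint_def by blast
  have hit: "\<exists>i. (i, \<phi> i) \<in> T" if "\<phi> \<in> WHom G H" for \<phi>
    using T that by (auto simp: minimal_transversal_def transversal_graphs_iff)
  \<comment> \<open>The image of \<open>{x}\<close> under \<open>R\<close> is the component of
    \<open>x\<close> in \<open>G\<close>.\<close>
  define R where "R = {(x, y). {x, y} \<in> G}\<^sup>*"
  have R_edge: "R `` {x} = R `` {y}" if "{x, y} \<in> G" for x y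
  proof -
    have "(x, y) \<in> R" "(y, x) \<in> R"
      using that by (auto simp: R_def insert_commute)
    then show ?thesis
      unfolding R_def by (blast intro: rtrancl_trans)
  qed
  have "\<exists>x. \<forall>C\<in>P. \<exists>i\<in>R `` {x}. {i} \<times> C \<subseteq> T"
  proof (rule ccontr)
    assume "\<not> ?thesis"
    then have free: "\<exists>C. C \<in> P \<and> (\<forall>i\<in>R `` {x}. \<not> {i} \<times> C \<subseteq> T)" for x
      by meson
    \<comment> \<open>The clique is chosen as a function of the component, not of the vertex, so
      adjacent vertices get the same clique. Any map choosing values in these cliques is then a weak
      homomorphism, and its values can be picked to avoid \<open>T\<close>.\<close>
    define Q where "Q S = (SOME C. C \<in> P \<and> (\<forall>i\<in>S. \<not> {i} \<times> C \<subseteq> T))" for S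
    have Q: "Q (R `` {x}) \<in> P \<and> (\<forall>i\<in>R `` {x}. \<not> {i} \<times> Q (R `` {x}) \<subseteq> T)" for x
      unfolding Q_def by (rule someI_ex[OF free])
    have "x \<in> R `` {x}" for x
      by (simp add: R_def)
    then have "\<not> {x} \<times> Q (R `` {x}) \<subseteq> T" for x
      using Q by blast
    then have "\<exists>j. j \<in> Q (R `` {x}) \<and> (x, j) \<notin> T" for x
      by blast
    then obtain \<phi> where \<phi>: "\<And>x. \<phi> x \<in> Q (R `` {x}) \<and> (x, \<phi> x) \<notin> T"
      by metis
    have "\<phi> \<in> WHom G H"
      unfolding WHom_def
    proof (intro CollectI allI impI)
      fix x y assume "{x, y} \<in> G"
      then have "\<phi> y \<in> Q (R `` {x})"
        using \<phi>[of y] R_edge[of x y] by simp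
      then show "\<phi> x = \<phi> y \<or> {\<phi> x, \<phi> y} \<in> H"
        using \<phi>[of x] Q[of x] unfolding edge by blast
    qed
    then show False
      using hit \<phi> by blast
  qed
  then obtain x where "\<forall>C\<in>P. \<exists>i. i \<in> R `` {x} \<and> {i} \<times> C \<subseteq> T"
    unfolding Bex_def[of "R `` _"] by (elim exE)
  from bchoice[OF this] obtain i
    where i: "\<And>C. C \<in> P \<Longrightarrow> (x, i C) \<in> R \<and> {i C} \<times> C \<subseteq> T"
    by auto
  define cls where "cls j = (THE C. C \<in> P \<and> j \<in> C)" for j
  have cls: "cls j = C" if "C \<in> P" "j \<in> C" for C j
    unfolding cls_def
  proof (rule the_equality)
    show "C \<in> P \<and> j \<in> C"
      using that by (rule conjI)
    show "D = C" if "D \<in> P \<and> j \<in> D" for D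
      using unique[of D C j] that \<open>C \<in> P\<close> \<open>j \<in> C\<close> by simp
  qed
  have in_cls: "cls j \<in> P" "j \<in> cls j" for j
  proof -
    obtain C where "C \<in> P" "j \<in> C"
      using P by (auto simp: partition_on_def)
    then show "cls j \<in> P" "j \<in> cls j"
      using cls[of C j] by simp_all
  qed
  \<comment> \<open>This selects one point per column, with a row depending only on the clique of
    the column.\<close>
  let ?T = "range (\<lambda>j. (i (cls j), j))"
  have "transversal (graph_of ` WHom G H) ?T"
    unfolding transversal_graphs_iff
  proof
    fix \<phi> assume \<phi>: "\<phi> \<in> WHom G H"
    \<comment> \<open>A weak homomorphism sends the component of \<open>x\<close> into a single
      clique. The row chosen for that clique lies in the component, so the graph of
      \<open>\<phi>\<close> meets \<open>?T\<close> there.\<close>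
    have const: "\<phi> y \<in> cls (\<phi> x)" if "(x, y) \<in> R" for y
      using that unfolding R_def
    proof (induction rule: rtrancl_induct)
      case base
      show ?case
        by (rule in_cls)
    next
      case (step y z)
      then have "\<phi> y = \<phi> z \<or> {\<phi> y, \<phi> z} \<in> H"
        using \<phi> by (auto simp: WHom_def)
      then show ?case
        using edge step.IH in_cls(1) unique by metis
    qed
    let ?i = "i (cls (\<phi> x))"
    have "\<phi> ?i \<in> cls (\<phi> x)"
      using const i in_cls(1) by blast
    then have "cls (\<phi> ?i) = cls (\<phi> x)"
      using cls in_cls(1) by blast
    then show "\<exists>y. (y, \<phi> y) \<in> ?T"
      by (intro exI[of _ ?i] range_eqI[of _ _ "\<phi> ?i"]) simp
  qed
  moreover have "?T \<subseteq> T"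
    using i in_cls by blast
  ultimately have "T = ?T"
    using T unfolding minimal_transversal_def by blast
  moreover have "card ?T = card (UNIV :: 'b set)"
    by (intro card_image) (simp add: inj_on_def)
  ultimately show ?thesis
    by simp
qed

theorem theorem2p7:
  fixes G :: "'a::finite set set" and H :: "'b::finite set set"
  assumes "simple_graph G" and "simple_graph H"
  shows "unmixed xpoly_ring (whom_ideal G H :: ('a, 'b, 'k::field) xpoly set) \<longleftrightarrow>
    totally_disconnected G \<or> disjoint_union_of_complete_graphs H"
  unfolding whom_ideal_eq_edge_ideal unmixed_edge_ideal_iff
proof (intro iffI allI impI)
  assume eq: "\<forall>C D. minimal_transversal (graph_of ` WHom G H) C \<and>
    minimal_transversal (graph_of ` WHom G H) D \<longrightarrow> card C = card D"
  show "totally_disconnected G \<or> disjoint_union_of_complete_graphs H"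
  proof (rule ccontr)
    assume *: "\<not> ?thesis"
    then obtain e where "e \<in> G"
      by (auto simp: totally_disconnected_def)
    then obtain p q where pq: "{p, q} \<in> G" "p \<noteq> q"
      using assms(1) by (auto simp: simple_graph_def card_2_iff)
    obtain T where T: "minimal_transversal (graph_of ` WHom G H) T" "card (UNIV :: 'b set) < card T"
      using * exists_induced_path[OF assms(2)] exists_large_minimal_transversal[OF pq] by metis
    have "card T = card ({p} \<times> (UNIV :: 'b set))"
      by (rule eq[rule_format, OF conjI[OF T(1) minimal_transversal_row]])
    then show False
      using T(2) by (simp add: card_cartesian_product)
  qed
next
  fix C D
  assume GH: "totally_disconnected G \<or> disjoint_union_of_complete_graphs H"
    and CD: "minimal_transversal (graph_of ` WHom G H) C \<and> minimal_transversal (graph_of ` WHom G H) D"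
  have "card T = card (UNIV :: 'b set)" if "minimal_transversal (graph_of ` WHom G H) T" for T
    using GH that card_minimal_transversal_totally_disconnected[of H T]
      card_minimal_transversal_cliques[of H G T]
    by (auto simp: totally_disconnected_def)
  then show "card C = card D"
    using CD by simp
qed

end
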